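(* Let $\rho\in\mathcal P(\mathbb R^d)$ satisfy $\lim_{r\to0}\mu_\rho(r)<\frac{1}{N(N-1)^2}$, and let $\beta>0$ be such that $$\mu_\rho(\beta)<\frac{1}{N(N-1)^2}.$$ Then $$C(\rho)\le\frac{N^3(N-1)^2}{4}\,\phi(\beta).$$ Moreover, $$C(\rho)=C_\alpha(\rho)\qquad\text{whenever}\qquad 0<\alpha\le\phi^{-1}\Big(\frac{N^2(N-1)}{2}\,\phi(\beta)\Big).$$
   Context: $d\ge1$ and $N>1$ are integers; $\mathcal P(X)$ is the set of Borel probability measures on $X$. The function $\phi:(0,+\infty)\to[0,+\infty)$ is continuous, strictly decreasing, and $\lim_{t\to0^+}\phi(t)=+\infty$; by convention $\phi(0)=+\infty$. The cost is $c(x_1,\dots,x_N)=\sum_{1\le i<j\le N}\phi(|x_i-x_j|)$ for $x_1,\dots,x_N\in\mathbb R^d$. For $\alpha>0$ the truncated cost is $c_\alpha(x_1,\dots,x_N)=\sum_{1\le i<j\le N}\min\{\phi(|x_i-x_j|),\phi(\alpha)\}$. $\Pi(\rho)$ is the set of $P\in\mathcal P(\mathbb R^{Nd})$ all of whose $N$ marginals on the factors $\mathbb R^d$ are equal to $\rho$. Set $C(\rho)=\min_{P\in\Pi(\rho)}\int c\,dP$ and $C_\alpha(\rho)=\min_{P\in\Pi(\rho)}\int c_\alpha\,dP$. Measure of concentration: $\mu_\rho(r)=\sup_{x\in\mathbb R^d}\rho(B(x,r))$, with $B(x,r)$ the open ball. *)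

theory Defs
  imports "HOL-Probability.Probability"
begin

text \<open>
  Points \<open>(x\<^sub>1, \<dots>, x\<^sub>N)\<close> of \<open>(\<real>\<^sup>d)\<^sup>N\<close> are represented by functions
  \<open>x\<close> on the index set \<open>{..<N}\<close>, so indices are shifted by one. Costs take values in
  \<open>ennreal\<close>, because \<open>c\<close> is infinite as soon as two of the points coincide.
\<close>

text \<open>The convention \<open>\<phi>(0) = +\<infinity>\<close>; only arguments \<open>t \<ge> 0\<close> matter.\<close>

definition ext_phi :: "(real \<Rightarrow> real) \<Rightarrow> real \<Rightarrow> ennreal" where
  "ext_phi \<phi> t = (if t = 0 then \<infinity> else ennreal (\<phi> t))"

definition cost :: "(real \<Rightarrow> real) \<Rightarrow> nat \<Rightarrow> (nat \<Rightarrow> 'a::euclidean_space) \<Rightarrow> ennreal" where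
  "cost \<phi> N x = (\<Sum>j<N. \<Sum>i<j. ext_phi \<phi> (norm (x i - x j)))"

definition trunc_cost ::
  "(real \<Rightarrow> real) \<Rightarrow> real \<Rightarrow> nat \<Rightarrow> (nat \<Rightarrow> 'a::euclidean_space) \<Rightarrow> ennreal" where
  "trunc_cost \<phi> \<alpha> N x =
     (\<Sum>j<N. \<Sum>i<j. min (ext_phi \<phi> (norm (x i - x j))) (ext_phi \<phi> \<alpha>))"

text \<open>
  The product \<open>\<sigma>\<close>-algebra of finitely many copies of the Borel \<open>\<sigma>\<close>-algebra of \<open>\<real>\<^sup>d\<close>
  is the Borel \<open>\<sigma>\<close>-algebra of \<open>\<real>\<^sup>N\<^sup>d\<close>, by second countability.
\<close>

definition plans :: "nat \<Rightarrow> 'a::euclidean_space measure \<Rightarrow> (nat \<Rightarrow> 'a) measure set" where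
  "plans N \<rho> = {P. prob_space P \<and> sets P = sets (Pi\<^sub>M {..<N} (\<lambda>_. borel)) \<and>
                  (\<forall>i<N. distr P borel (\<lambda>x. x i) = \<rho>)}"

text \<open>
  The minimal costs are rendered as infima in the complete lattice \<open>ennreal\<close>, which
  are the minima whenever these are attained.
\<close>

definition min_cost :: "(real \<Rightarrow> real) \<Rightarrow> nat \<Rightarrow> 'a::euclidean_space measure \<Rightarrow> ennreal" where
  "min_cost \<phi> N \<rho> = (INF P\<in>plans N \<rho>. \<integral>\<^sup>+ x. cost \<phi> N x \<partial>P)"

definition min_trunc_cost ::
  "(real \<Rightarrow> real) \<Rightarrow> real \<Rightarrow> nat \<Rightarrow> 'a::euclidean_space measure \<Rightarrow> ennreal" where
  "min_trunc_cost \<phi> \<alpha> N \<rho> = (INF P\<in>plans N \<rho>. \<integral>\<^sup>+ x. trunc_cost \<phi> \<alpha> N x \<partial>P)"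

definition concentration :: "'a::euclidean_space measure \<Rightarrow> real \<Rightarrow> real" where
  "concentration \<rho> r = (SUP x. measure \<rho> (ball x r))"

end

theory Submission imports Defs begin

text \<open>
  Call a configuration bad if two of its points are closer than \<open>\<alpha>\<close>; off the bad set
  \<open>c\<^sub>\<alpha> = c\<close>, and on it \<open>c\<^sub>\<alpha> \<ge> \<phi>(\<alpha>)\<close>. Given a plan \<open>P\<close>, draw a bad
  configuration \<open>\<omega>\<^sub>0\<close> from \<open>P\<close> and then \<open>\<omega>\<^sub>1, \<dots>, \<omega>\<^bsub>N-1\<^esub>\<close> successively from
  \<open>P\<close> such that different components of different configurations are at distance at least
  \<open>\<beta>\<close>. At each stage the forbidden event has probability at most
  \<open>N(N-1)\<^sup>2 \<mu>\<^sub>\<rho>(\<beta>) < 1\<close>. Now move a small amount of mass from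
  \<open>\<omega>\<^sub>0, \<dots>, \<omega>\<^bsub>N-1\<^esub>\<close> to the \<open>N\<close> configurations obtained by shifting the components
  cyclically among them. The marginals do not change; the \<open>N\<close> new configurations are not bad and
  their total cost is at most \<open>N\<^sup>2(N-1)/2 \<phi>(\<beta>) \<le> \<phi>(\<alpha>)\<close>, which is at most what was removed.

  Each such step shrinks the bad mass by a fixed factor. Once the bad mass is small, the
  \<open>\<omega>\<^sub>k\<close> with \<open>k \<ge> 1\<close> can be drawn from the complement of the bad set, and then a single
  step removes all of it. So finitely many steps suffice, and neither a limit nor the existence of
  minimisers is needed. The bound on \<open>C(\<rho>)\<close> follows from \<open>C(\<rho>) = C\<^sub>\<alpha>(\<rho>)\<close> with the largest
  admissible \<open>\<alpha>\<close>, because \<open>c\<^sub>\<alpha> \<le> N(N-1)/2 \<phi>(\<alpha>)\<close>.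
\<close>

subsection \<open>Finite sums of measures\<close>

text \<open>\<open>M\<close> supplies the space and the sigma-algebra on which the
  \<open>F i\<close> are added. Both the mass taken from a plan and the mass put back are assembled
  with this sum.\<close>

definition sum_measure :: "'a measure \<Rightarrow> ('i \<Rightarrow> 'a measure) \<Rightarrow> 'i set \<Rightarrow> 'a measure" where
  "sum_measure M F I = measure_of (space M) (sets M) (\<lambda>A. \<Sum>i\<in>I. emeasure (F i) A)"

lemma sets_sum_measure [simp, measurable_cong]: "sets (sum_measure M F I) = sets M"
  and space_sum_measure [simp]: "space (sum_measure M F I) = space M"
  by (simp_all add: sum_measure_def)

lemma emeasure_sum_measure:
  assumes sets: "\<And>i. i \<in> I \<Longrightarrow> sets (F i) = sets M" and A: "A \<in> sets M"
  shows "emeasure (sum_measure M F I) A = (\<Sum>i\<in>I. emeasure (F i) A)"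
  unfolding sum_measure_def
proof (rule emeasure_measure_of_sigma)
  show "sigma_algebra (space M) (sets M)" ..
  show "positive (sets M) (\<lambda>A. \<Sum>i\<in>I. emeasure (F i) A)"
    by (simp add: positive_def)
  show "countably_additive (sets M) (\<lambda>A. \<Sum>i\<in>I. emeasure (F i) A)"
  proof (rule countably_additiveI)
    fix A :: "nat \<Rightarrow> _" assume A: "range A \<subseteq> sets M" "disjoint_family A"
    have "(\<Sum>n. \<Sum>i\<in>I. emeasure (F i) (A n)) = (\<Sum>i\<in>I. \<Sum>n. emeasure (F i) (A n))"
      by (rule suminf_sum) (rule summableI)
    also have "\<dots> = (\<Sum>i\<in>I. emeasure (F i) (\<Union>n. A n))"
      using A sets by (intro sum.cong refl suminf_emeasure) auto
    finally show "(\<Sum>n. \<Sum>i\<in>I. emeasure (F i) (A n)) = (\<Sum>i\<in>I. emeasure (F i) (\<Union>n. A n))" .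
  qed
qed (rule A)

text \<open>Induction on measurable functions: for indicators this is the value of the sum on a set,
  and in the monotone limit suprema of increasing sequences pass through the sum. Integrals of the
  cost thus split along a decomposition of a plan.\<close>

lemma nn_integral_sum_measure:
  assumes sets: "\<And>i. i \<in> I \<Longrightarrow> sets (F i) = sets M" and f: "f \<in> borel_measurable M"
  shows "(\<integral>\<^sup>+x. f x \<partial>sum_measure M F I) = (\<Sum>i\<in>I. \<integral>\<^sup>+x. f x \<partial>F i)"
proof -
  have sp: "space (F i) = space M" if "i \<in> I" for i
    using sets[OF that] by (rule sets_eq_imp_space_eq)
  have ms: "u \<in> borel_measurable (sum_measure M F I)" "i \<in> I \<Longrightarrow> u \<in> borel_measurable (F i)"
    if "u \<in> borel_measurable M" for u :: "_ \<Rightarrow> ennreal" and i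
    using that sets by (simp_all cong: measurable_cong_sets)
  show ?thesis
    using f
  proof induction
    case (cong f g)
    have "(\<integral>\<^sup>+x. f x \<partial>sum_measure M F I) = (\<integral>\<^sup>+x. g x \<partial>sum_measure M F I)"
      using cong(3) by (intro nn_integral_cong) simp
    moreover have "(\<integral>\<^sup>+x. f x \<partial>F i) = (\<integral>\<^sup>+x. g x \<partial>F i)" if "i \<in> I" for i
      using cong(3) sp[OF that] by (intro nn_integral_cong) simp
    ultimately show ?case
      using cong(4) by simp
  next
    case (set A)
    then show ?case
      using sets by (simp add: emeasure_sum_measure)
  next
    case (mult u c)
    then show ?case
      by (simp add: ms nn_integral_cmult sum_distrib_left)
  next
    case (add u v)
    then show ?case
      by (simp add: ms nn_integral_add sum.distrib)
  next
    case (seq U)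
    have inc: "incseq (\<lambda>n. integral\<^sup>N K (U n))" for K
      using seq(3) by (auto simp: incseq_def le_fun_def intro!: nn_integral_mono)
    have "(\<integral>\<^sup>+x. (SUP n. U n) x \<partial>sum_measure M F I) = (SUP n. \<integral>\<^sup>+x. U n x \<partial>sum_measure M F I)"
      using seq(1,3) by (simp add: ms image_comp nn_integral_monotone_convergence_SUP)
    also have "\<dots> = (SUP n. \<Sum>i\<in>I. \<integral>\<^sup>+x. U n x \<partial>F i)"
      using seq by simp
    also have "\<dots> = (\<Sum>i\<in>I. SUP n. \<integral>\<^sup>+x. U n x \<partial>F i)"
      by (rule ennreal_SUP_sum) (rule inc)
    also have "\<dots> = (\<Sum>i\<in>I. \<integral>\<^sup>+x. (SUP n. U n) x \<partial>F i)"
      using seq(1,3)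
      by (intro sum.cong refl) (simp add: ms image_comp nn_integral_monotone_convergence_SUP)
    finally show ?case .
  qed
qed

subsection \<open>Greedy random selection\<close>

lemma divide_left_antimono_ennreal:
  fixes a b c :: ennreal
  assumes "b \<le> c"
  shows "a / c \<le> a / b"
proof -
  have "inverse c \<le> inverse b"
    using assms by (simp add: less_eq_ennreal.rep_eq inverse_ennreal.rep_eq ereal_inverse_antimono)
  then show ?thesis
    unfolding divide_ennreal_def by (rule mult_left_mono) simp
qed

text \<open>The entry \<open>\<omega> 0\<close> is exempt from \<open>A\<close>, since it will be
  drawn from another set. Each later entry is tested only against the entries drawn before it, as in
  successive sampling.\<close>

definition chain :: "'a set \<Rightarrow> ('a \<Rightarrow> 'a \<Rightarrow> bool) \<Rightarrow> nat \<Rightarrow> (nat \<Rightarrow> 'a) \<Rightarrow> bool" where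
  "chain A R n \<omega> \<longleftrightarrow> (\<forall>k\<in>{1..<n}. \<omega> k \<in> A \<and> (\<forall>j<k. R (\<omega> j) (\<omega> k)))"

lemma chain_1 [simp]: "chain A R (Suc 0) \<omega>"
  by (simp add: chain_def)

lemma chain_Suc:
  assumes "0 < n"
  shows "chain A R (Suc n) \<omega> \<longleftrightarrow> chain A R n \<omega> \<and> \<omega> n \<in> A \<and> (\<forall>j<n. R (\<omega> j) (\<omega> n))"
  using assms by (auto simp: chain_def less_Suc_eq)

lemma chain_cong:
  assumes "\<And>k. k < n \<Longrightarrow> \<omega> k = \<omega>' k"
  shows "chain A R n \<omega> \<longleftrightarrow> chain A R n \<omega>'"
  using assms by (auto simp: chain_def)

context prob_space
begin

lemma measurable_chain:
  assumes A: "A \<in> sets M"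
    and R: "Measurable.pred (M \<Otimes>\<^sub>M M) (\<lambda>(x, y). R x y)"
    and f: "\<And>k. k < n \<Longrightarrow> (\<lambda>x. f x k) \<in> measurable K M"
  shows "Measurable.pred K (\<lambda>x. chain A R n (f x))"
proof -
  have "Measurable.pred K (\<lambda>x. \<forall>k\<in>{1..<n}. f x k \<in> A \<and> (\<forall>j\<in>{..<k}. R (f x j) (f x k)))"
  proof (intro pred_intros_finite(3)[OF finite_atLeastLessThan]
      pred_intros_finite(3)[OF finite_lessThan] pred_intros_logic(3))
    fix k assume k: "k \<in> {1..<n}"
    show "Measurable.pred K (\<lambda>x. f x k \<in> A)"
      using k by (intro pred_sets2[OF A] f) simp
    show "Measurable.pred K (\<lambda>x. R (f x j) (f x k))" if j: "j \<in> {..<k}" for j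
    proof -
      have "(\<lambda>x. (f x j, f x k)) \<in> measurable K (M \<Otimes>\<^sub>M M)"
        using j k by (intro measurable_Pair f) simp_all
      from measurable_compose[OF this R] show ?thesis
        by (simp only: prod.case)
    qed
  qed
  then show ?thesis
    by (simp only: chain_def Ball_def lessThan_iff)
qed

text \<open>The entries after \<open>a\<close> are drawn independently from \<open>M\<close>.
  Whatever the earlier entries are, the last one is admissible with probability at least
  \<open>d\<close>; integrating it out first, the \<open>n\<close> factors multiply.\<close>

lemma chain_prob_ge:
  assumes A: "A \<in> sets M" and R: "Measurable.pred (M \<Otimes>\<^sub>M M) (\<lambda>(x, y). R x y)"
    and sel: "\<And>F. finite F \<Longrightarrow> F \<subseteq> space M \<Longrightarrow> card F \<le> n \<Longrightarrow>
      d \<le> emeasure M {y\<in>A. \<forall>x\<in>F. R x y}"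
    and a: "a \<in> space M"
  shows "d ^ n \<le> (\<integral>\<^sup>+x. indicator {\<omega>. chain A R (Suc n) \<omega>} (x(0 := a)) \<partial>Pi\<^sub>M {1..<Suc n} (\<lambda>_. M))"
  using sel
proof (induction n)
  case 0
  interpret P: prob_space "Pi\<^sub>M {1..<Suc 0} (\<lambda>_. M)"
    by (rule prob_space_PiM) (rule prob_space_axioms)
  show ?case
    using P.emeasure_space_1 by simp
next
  case (Suc n)
  interpret PP: product_sigma_finite "\<lambda>_::nat. M"
    by (simp add: product_sigma_finite_def sigma_finite_measure_axioms)
  let ?I = "{1..<Suc n}"
  have ins: "{1..<Suc (Suc n)} = insert (Suc n) ?I"
    by auto
  let ?g = "\<lambda>m x. indicator {\<omega>. chain A R m \<omega>} (x(0 := a)) :: ennreal"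
  have meas: "?g (Suc m) \<in> borel_measurable (Pi\<^sub>M {1..<Suc m} (\<lambda>_. M))" for m
  proof -
    have "Measurable.pred (Pi\<^sub>M {1..<Suc m} (\<lambda>_. M)) (\<lambda>x. chain A R (Suc m) (x(0 := a)))"
    proof (rule measurable_chain[OF A R])
      show "(\<lambda>x. (x(0 := a)) k) \<in> measurable (Pi\<^sub>M {1..<Suc m} (\<lambda>_. M)) M" if "k < Suc m" for k
        using that a by (cases "k = 0") (simp_all add: measurable_component_singleton)
    qed
    then show ?thesis
      by (simp add: indicator_def)
  qed
  have "d ^ Suc n = d ^ n * d"
    by (simp add: mult.commute)
  also have "\<dots> \<le> (\<integral>\<^sup>+x. ?g (Suc n) x \<partial>Pi\<^sub>M ?I (\<lambda>_. M)) * d"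
    by (intro mult_right_mono Suc.IH Suc.prems) simp_all
  also have "\<dots> = (\<integral>\<^sup>+x. ?g (Suc n) x * d \<partial>Pi\<^sub>M ?I (\<lambda>_. M))"
    by (rule nn_integral_multc[symmetric]) (rule meas)
  also have "\<dots> \<le> (\<integral>\<^sup>+x. \<integral>\<^sup>+y. ?g (Suc (Suc n)) (x(Suc n := y)) \<partial>M \<partial>Pi\<^sub>M ?I (\<lambda>_. M))"
  proof (rule nn_integral_mono)
    fix x assume x: "x \<in> space (Pi\<^sub>M ?I (\<lambda>_. M))"
    \<comment> \<open>The entries drawn so far, \<open>a\<close> included, are indexed by
      \<open>Suc n\<close> numbers. Collecting them in a set can only lower the count, so
      \<open>sel\<close> applies.\<close>
    define F where "F = (\<lambda>j. (x(0 := a)) j) ` {..n}"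
    define S where "S = {y\<in>A. \<forall>z\<in>F. R z y}"
    have F: "F \<subseteq> space M"
      using x a by (auto simp: F_def space_PiM PiE_def Pi_def)
    have "card F \<le> Suc n"
      using card_image_le[of "{..n}" "x(0 := a)"] by (simp add: F_def)
    then have d: "d \<le> emeasure M S"
      unfolding S_def using F by (intro Suc.prems) (auto simp: F_def)
    have S: "S \<in> sets M"
    proof -
      have "Measurable.pred M (\<lambda>y. y \<in> A \<and> (\<forall>z\<in>F. R z y))"
      proof (intro pred_intros_logic pred_intros_finite)
        show "Measurable.pred M (R z)" if "z \<in> F" for z
          using measurable_compose[OF measurable_Pair1'[of z M M] R] F that by auto
      qed (use A in \<open>auto simp: F_def\<close>)
      then have "{y\<in>space M. y \<in> A \<and> (\<forall>z\<in>F. R z y)} \<in> sets M"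
        by simp
      moreover have "{y\<in>space M. y \<in> A \<and> (\<forall>z\<in>F. R z y)} = S"
        using sets.sets_into_space[OF A] by (auto simp: S_def)
      ultimately show ?thesis by simp
    qed
    \<comment> \<open>Overwriting coordinate \<open>Suc n\<close> leaves the earlier part of the
      chain untouched, so the condition factors and the inner integral is the mass of
      \<open>S\<close> times a constant.\<close>
    have split: "?g (Suc (Suc n)) (x(Suc n := y)) = ?g (Suc n) x * indicator S y" for y
    proof -
      have "chain A R (Suc n) (x(Suc n := y, 0 := a)) \<longleftrightarrow> chain A R (Suc n) (x(0 := a))"
        by (rule chain_cong) auto
      then show ?thesis
        by (auto simp: chain_Suc[of "Suc n"] indicator_def S_def F_def less_Suc_eq_le)
    qed
    have "?g (Suc n) x * d \<le> ?g (Suc n) x * emeasure M S"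
      using d by (rule mult_left_mono) simp
    also have "\<dots> = (\<integral>\<^sup>+y. ?g (Suc (Suc n)) (x(Suc n := y)) \<partial>M)"
      unfolding split using S by (subst nn_integral_cmult) auto
    finally show "?g (Suc n) x * d \<le> (\<integral>\<^sup>+y. ?g (Suc (Suc n)) (x(Suc n := y)) \<partial>M)" .
  qed
  also have "\<dots> = (\<integral>\<^sup>+x. ?g (Suc (Suc n)) x \<partial>Pi\<^sub>M (insert (Suc n) ?I) (\<lambda>_. M))"
    using meas[of "Suc n"] unfolding ins
    by (subst PP.product_nn_integral_insert) simp_all
  also note ins[symmetric]
  finally show ?case .
qed

text \<open>\<open>\<Gamma>\<close> is the product measure weighted by the indicator of a chain
  starting in \<open>B\<close>, over the probability \<open>h\<close> that the start extends to a
  chain. Since \<open>h\<close> is at least \<open>d ^ n\<close>, the weight is at most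
  \<open>1 / d ^ n\<close>, which controls the laws of the later coordinates. The total mass of
  \<open>\<Gamma>\<close> is that of \<open>B\<close>.\<close>

lemma greedy_selection:
  assumes B: "B \<in> sets M" and A: "A \<in> sets M"
    and R: "Measurable.pred (M \<Otimes>\<^sub>M M) (\<lambda>(x, y). R x y)"
    and d: "0 < d"
    and sel: "\<And>F. finite F \<Longrightarrow> F \<subseteq> space M \<Longrightarrow> card F \<le> n \<Longrightarrow>
      d \<le> emeasure M {y\<in>A. \<forall>x\<in>F. R x y}"
  obtains \<Gamma> where "sets \<Gamma> = sets (Pi\<^sub>M {..n} (\<lambda>_. M))"
    and "AE \<omega> in \<Gamma>. \<omega> 0 \<in> B \<and> chain A R (Suc n) \<omega>"
    and "\<And>X. X \<in> sets M \<Longrightarrow> emeasure \<Gamma> {\<omega>\<in>space \<Gamma>. \<omega> 0 \<in> X} = emeasure M (B \<inter> X)"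
    and "\<And>X k. X \<in> sets M \<Longrightarrow> 0 < k \<Longrightarrow> k \<le> n \<Longrightarrow>
      emeasure \<Gamma> {\<omega>\<in>space \<Gamma>. \<omega> k \<in> X} \<le> emeasure M B / d ^ n * emeasure M (A \<inter> X)"
proof -
  interpret PP: product_sigma_finite "\<lambda>_::nat. M"
    by (simp add: product_sigma_finite_def sigma_finite_measure_axioms)
  define I where "I = {1..<Suc n}"
  have I: "finite I" "0 \<notin> I" "insert 0 I = {..n}"
    by (auto simp: I_def)
  define Q where "Q = Pi\<^sub>M {..n} (\<lambda>_. M)"
  define g :: "(nat \<Rightarrow> 'a) \<Rightarrow> ennreal" where "g = indicator {\<omega>. chain A R (Suc n) \<omega>}"
  define h where "h a = (\<integral>\<^sup>+x. g (x(0 := a)) \<partial>Pi\<^sub>M I (\<lambda>_. M))" for a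
  have comp [measurable]: "(\<lambda>\<omega>. \<omega> k) \<in> measurable Q M" if "k \<le> n" for k
    unfolding Q_def using that by (intro measurable_component_singleton) simp
  have g [measurable]: "g \<in> borel_measurable Q"
  proof -
    have "Measurable.pred Q (\<lambda>x. chain A R (Suc n) x)"
      by (rule measurable_chain[OF A R]) (simp add: comp)
    then show ?thesis
      by (simp add: g_def indicator_def)
  qed
  have upd: "(\<lambda>(a, x). x(0 := a)) \<in> measurable (M \<Otimes>\<^sub>M Pi\<^sub>M I (\<lambda>_. M)) Q"
    unfolding Q_def case_prod_beta
    by (rule measurable_fun_upd[of _ I]) (use I in auto)
  have h [measurable]: "h \<in> borel_measurable M"
  proof -
    interpret J: finite_product_sigma_finite "\<lambda>_::nat. M" I
      by unfold_locales (rule I)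
    have "(\<lambda>(a, x). g (x(0 := a))) \<in> borel_measurable (M \<Otimes>\<^sub>M Pi\<^sub>M I (\<lambda>_. M))"
      using measurable_compose[OF upd g] by (simp add: case_prod_beta)
    then show ?thesis
      unfolding h_def by (rule J.borel_measurable_nn_integral)
  qed
  have h_ge: "d ^ n \<le> h a" if "a \<in> space M" for a
    unfolding h_def g_def I_def by (rule chain_prob_ge[OF A R sel that])
  have h_le: "h a \<le> 1" for a
  proof -
    interpret J: prob_space "Pi\<^sub>M I (\<lambda>_. M)"
      by (rule prob_space_PiM) (rule prob_space_axioms)
    have "h a \<le> (\<integral>\<^sup>+x. 1 \<partial>Pi\<^sub>M I (\<lambda>_. M))"
      unfolding h_def g_def by (intro nn_integral_mono) (simp add: indicator_def)
    then show ?thesis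
      by (simp add: J.emeasure_space_1)
  qed
  \<comment> \<open>dividing by \<open>h\<close> makes the law of \<open>\<omega> 0\<close> exactly \<open>M\<close> restricted to \<open>B\<close>\<close>
  define w where "w \<omega> = indicator B (\<omega> 0) * g \<omega> / h (\<omega> 0)" for \<omega>
  have w [measurable]: "w \<in> borel_measurable Q"
    unfolding w_def using B by measurable
  define \<Gamma> where "\<Gamma> = density Q w"
  have em: "emeasure \<Gamma> {\<omega>\<in>space \<Gamma>. \<omega> k \<in> X} = (\<integral>\<^sup>+\<omega>. w \<omega> * indicator X (\<omega> k) \<partial>Q)"
    if X: "X \<in> sets M" and k: "k \<le> n" for X k
  proof -
    have "{\<omega>\<in>space Q. \<omega> k \<in> X} \<in> sets Q"
      using measurable_sets[OF comp[OF k] X] by (simp add: vimage_def Int_def conj_commute)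
    then have "emeasure \<Gamma> {\<omega>\<in>space \<Gamma>. \<omega> k \<in> X} = (\<integral>\<^sup>+\<omega>. w \<omega> * indicator {\<omega>\<in>space Q. \<omega> k \<in> X} \<omega> \<partial>Q)"
      by (simp add: \<Gamma>_def emeasure_density)
    also have "\<dots> = (\<integral>\<^sup>+\<omega>. w \<omega> * indicator X (\<omega> k) \<partial>Q)"
      by (intro nn_integral_cong) (simp add: indicator_def)
    finally show ?thesis .
  qed
  show thesis
  proof (rule that)
    show "sets \<Gamma> = sets (Pi\<^sub>M {..n} (\<lambda>_. M))"
      by (simp add: \<Gamma>_def Q_def)
    have "AE \<omega> in Q. 0 < w \<omega> \<longrightarrow> \<omega> 0 \<in> B \<and> chain A R (Suc n) \<omega>"
      by (intro AE_I2) (auto simp: w_def g_def indicator_def split: if_splits)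
    then show "AE \<omega> in \<Gamma>. \<omega> 0 \<in> B \<and> chain A R (Suc n) \<omega>"
      unfolding \<Gamma>_def by (subst AE_density[OF w])
  next
    fix X assume X: "X \<in> sets M"
    have [measurable]: "(\<lambda>\<omega>. w \<omega> * indicator X (\<omega> 0)) \<in> borel_measurable Q"
      using X by measurable
    have "emeasure \<Gamma> {\<omega>\<in>space \<Gamma>. \<omega> 0 \<in> X} = (\<integral>\<^sup>+\<omega>. w \<omega> * indicator X (\<omega> 0) \<partial>Q)"
      using X by (simp add: em)
    also have "\<dots> = (\<integral>\<^sup>+a. \<integral>\<^sup>+x. w (x(0 := a)) * indicator X a \<partial>Pi\<^sub>M I (\<lambda>_. M) \<partial>M)"
      unfolding Q_def I(3)[symmetric] by (subst PP.product_nn_integral_insert_rev)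
        (use I in \<open>simp_all flip: Q_def\<close>)
    also have "\<dots> = (\<integral>\<^sup>+a. indicator (B \<inter> X) a \<partial>M)"
    proof (rule nn_integral_cong)
      fix a assume a: "a \<in> space M"
      have upd': "(\<lambda>x. x(0 := a)) \<in> measurable (Pi\<^sub>M I (\<lambda>_. M)) Q"
        using measurable_compose[OF measurable_Pair1'[OF a] upd] by simp
      have "(\<integral>\<^sup>+x. w (x(0 := a)) * indicator X a \<partial>Pi\<^sub>M I (\<lambda>_. M)) =
          (\<integral>\<^sup>+x. indicator (B \<inter> X) a / h a * g (x(0 := a)) \<partial>Pi\<^sub>M I (\<lambda>_. M))"
        by (intro nn_integral_cong) (auto simp: w_def indicator_def divide_ennreal_def mult_ac)
      also have "\<dots> = indicator (B \<inter> X) a / h a * h a"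
        unfolding h_def using measurable_compose[OF upd' g] by (rule nn_integral_cmult)
      also have "\<dots> = indicator (B \<inter> X) a"
      proof -
        \<comment> \<open>Cancelling in \<open>ennreal\<close> requires \<open>h a\<close> to be
          neither zero nor infinite; its lower and upper bounds provide this.\<close>
        have "d ^ n \<noteq> 0"
          using d by simp
        then have "h a \<noteq> 0" "h a \<noteq> top"
          using h_ge[OF a] h_le[of a] by (auto simp: top_unique)
        then show ?thesis
          unfolding ennreal_divide_times[of _ "h a"] by (simp add: less_top)
      qed
      finally show "(\<integral>\<^sup>+x. w (x(0 := a)) * indicator X a \<partial>Pi\<^sub>M I (\<lambda>_. M)) = indicator (B \<inter> X) a" .
    qed
    also have "\<dots> = emeasure M (B \<inter> X)"
      using B X by simp
    finally show "emeasure \<Gamma> {\<omega>\<in>space \<Gamma>. \<omega> 0 \<in> X} = emeasure M (B \<inter> X)" .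
  next
    fix X k assume X: "X \<in> sets M" and k: "0 < k" "k \<le> n"
    \<comment> \<open>This box constrains only the coordinates \<open>0\<close> and
      \<open>k\<close>. The others contribute factors 1, so its mass is the product of those of
      \<open>B\<close> and \<open>A \<inter> X\<close>.\<close>
    define F where "F i = (if i = 0 then B else if i = k then A \<inter> X else space M)" for i
    have F: "F i \<in> sets M" for i
      using A B X by (simp add: F_def)
    have "emeasure \<Gamma> {\<omega>\<in>space \<Gamma>. \<omega> k \<in> X} = (\<integral>\<^sup>+\<omega>. w \<omega> * indicator X (\<omega> k) \<partial>Q)"
      using X k by (simp add: em)
    also have "\<dots> \<le> (\<integral>\<^sup>+\<omega>. 1 / d ^ n * indicator (Pi\<^sub>E {..n} F) \<omega> \<partial>Q)"
    proof (rule nn_integral_mono)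
      fix \<omega> assume \<omega>: "\<omega> \<in> space Q"
      then have "\<omega> 0 \<in> space M"
        by (auto simp: Q_def space_PiM)
      show "w \<omega> * indicator X (\<omega> k) \<le> 1 / d ^ n * indicator (Pi\<^sub>E {..n} F) \<omega>"
      proof (cases "\<omega> 0 \<in> B \<and> chain A R (Suc n) \<omega> \<and> \<omega> k \<in> X")
        case True
        then have "\<omega> k \<in> A"
          using k by (auto simp: chain_def)
        then have "\<omega> \<in> Pi\<^sub>E {..n} F"
          using \<omega> True by (auto simp: F_def Q_def space_PiM PiE_def Pi_def)
        moreover have "1 / h (\<omega> 0) \<le> 1 / d ^ n"
          using h_ge[OF \<open>\<omega> 0 \<in> space M\<close>] by (rule divide_left_antimono_ennreal)
        ultimately show ?thesis
          using True by (simp add: w_def g_def)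
      qed (auto simp: w_def g_def indicator_def)
    qed
    also have "\<dots> = 1 / d ^ n * emeasure Q (Pi\<^sub>E {..n} F)"
      unfolding Q_def using F by (intro nn_integral_cmult_indicator sets_PiM_I_finite) auto
    also have "emeasure Q (Pi\<^sub>E {..n} F) = (\<Prod>i\<in>{..n}. emeasure M (F i))"
      unfolding Q_def using F by (intro PP.emeasure_PiM) auto
    also have "\<dots> = (\<Prod>i\<in>{0, k}. emeasure M (F i))"
      using k by (intro prod.mono_neutral_right) (auto simp: F_def emeasure_space_1)
    also have "\<dots> = emeasure M B * emeasure M (A \<inter> X)"
      using k by (simp add: F_def)
    finally show "emeasure \<Gamma> {\<omega>\<in>space \<Gamma>. \<omega> k \<in> X} \<le> emeasure M B / d ^ n * emeasure M (A \<inter> X)"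
      by (simp add: divide_ennreal_def mult_ac)
  qed
qed

end

subsection \<open>Rerouting mass away from the diagonal\<close>

text \<open>There are \<open>N (N - 1) / 2\<close> pairs \<open>i < j < N\<close>; a negative
  \<open>c\<close> is cut to 0 by \<open>ennreal\<close> on both sides.\<close>

lemma sum_pairs_le:
  assumes "\<And>i j. i < j \<Longrightarrow> j < N \<Longrightarrow> f i j \<le> ennreal c"
  shows "(\<Sum>j<N. \<Sum>i<j. f i j) \<le> ennreal (real N * (real N - 1) / 2 * c)"
proof -
  have c: "ennreal (real m * c) = of_nat m * ennreal c" for m
    by (cases "0 \<le> c") (simp_all add: ennreal_mult ennreal_of_nat_eq_real_of_nat ennreal_neg mult_nonneg_nonpos)
  have "real (\<Sum>j<N. j) = real N * (real N - 1) / 2"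
    by (induction N) (auto simp: field_simps)
  then have "ennreal (real N * (real N - 1) / 2 * c) = of_nat (\<Sum>j<N. j) * ennreal c"
    by (simp only: flip: c)
  also have "\<dots> = (\<Sum>j<N. \<Sum>i<j. ennreal c)"
    by (simp add: sum_distrib_right)
  finally have "ennreal (real N * (real N - 1) / 2 * c) = (\<Sum>j<N. \<Sum>i<j. ennreal c)" .
  moreover have "(\<Sum>j<N. \<Sum>i<j. f i j) \<le> (\<Sum>j<N. \<Sum>i<j. ennreal c)"
    using assms by (intro sum_mono) simp
  ultimately show ?thesis
    by simp
qed

text \<open>Rotations permute the residues modulo \<open>N\<close>. Applied to the shift number,
  this says that the shifts use each draw once per component; applied to the component, that the
  components of one shift come from different draws.\<close>

lemma add_mod_bij_betw:
  assumes "i < N"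
  shows "bij_betw (\<lambda>k. (i + k) mod N) {..<N} {..<N :: nat}"
proof (rule bij_betw_imageI)
  show inj: "inj_on (\<lambda>k. (i + k) mod N) {..<N}"
    using assms by (auto intro!: inj_onI simp: mod_if split: if_splits)
  show "(\<lambda>k. (i + k) mod N) ` {..<N} = {..<N}"
    using assms by (intro endo_inj_surj inj) auto
qed

text \<open>\<open>q\<close> stands for the concentration at radius \<beta>, and
  \<open>phi_alpha\<close> replaces the condition on the inverse of \<phi>, so that the rerouting
  works with inequalities alone.\<close>

locale separated_rerouting =
  fixes \<phi> :: "real \<Rightarrow> real" and N :: nat and \<rho> :: "'a::euclidean_space measure"
    and \<alpha> \<beta> q :: real
  assumes N: "1 < N"
    and phi_cont: "continuous_on {0<..} \<phi>"
    and phi_anti: "\<And>s t. 0 < s \<Longrightarrow> s \<le> t \<Longrightarrow> \<phi> t \<le> \<phi> s"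
    and rho: "prob_space \<rho>" "sets \<rho> = sets borel"
    and alpha: "0 < \<alpha>" "\<alpha> \<le> \<beta>"
    and phi_alpha: "(real N)\<^sup>2 * (real N - 1) / 2 * \<phi> \<beta> \<le> \<phi> \<alpha>"
    and ball: "\<And>x. measure \<rho> (ball x \<beta>) \<le> q"
    and q: "real N * (real N - 1)\<^sup>2 * q < 1"
begin

abbreviation config :: "(nat \<Rightarrow> 'a) measure" where
  "config \<equiv> Pi\<^sub>M {..<N} (\<lambda>_. borel)"

definition bad :: "(nat \<Rightarrow> 'a) set" where
  "bad = {x\<in>space config. \<exists>j\<in>{..<N}. \<exists>i\<in>{..<j}. norm (x i - x j) < \<alpha>}"

text \<open>
  Equal indices are not compared, since each shifted configuration uses every component index
  exactly once; this gives the factor \<open>N(N-1)\<close> instead of \<open>N\<^sup>2\<close>.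
\<close>

definition apart :: "(nat \<Rightarrow> 'a) \<Rightarrow> (nat \<Rightarrow> 'a) \<Rightarrow> bool" where
  "apart x y \<longleftrightarrow> (\<forall>i\<in>{..<N}. \<forall>l\<in>{..<N} - {i}. \<beta> \<le> norm (x i - y l))"

text \<open>For fixed \<open>i\<close>, the index \<open>(i + k) mod N\<close> runs through all
  draws as \<open>k\<close> does, which preserves the marginals. The restriction to
  \<open>{..<N}\<close> keeps the result in the extensional product space.\<close>

definition shift :: "nat \<Rightarrow> (nat \<Rightarrow> nat \<Rightarrow> 'a) \<Rightarrow> nat \<Rightarrow> 'a" where
  "shift k \<omega> = (\<lambda>i\<in>{..<N}. \<omega> ((i + k) mod N) i)"

section \<open>Symmetry, measurability and marginals\<close>

lemma apart_commute: "apart x y \<longleftrightarrow> apart y x"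
  by (auto simp: apart_def norm_minus_commute)

lemma component_measurable: "i < N \<Longrightarrow> (\<lambda>x. x i) \<in> measurable config borel"
  by (rule measurable_component_singleton) simp

lemma bad_sets [measurable]: "bad \<in> sets config"
proof -
  have "Measurable.pred config (\<lambda>x. norm (x i - x j) < \<alpha>)" if "j \<in> {..<N}" "i \<in> {..<j}" for i j
  proof -
    have [measurable]: "(\<lambda>x. x i) \<in> measurable config borel" "(\<lambda>x. x j) \<in> measurable config borel"
      using that by (auto intro: component_measurable)
    show ?thesis by measurable
  qed
  then have "Measurable.pred config (\<lambda>x. \<exists>j\<in>{..<N}. \<exists>i\<in>{..<j}. norm (x i - x j) < \<alpha>)"
    by (intro pred_intros_finite) auto
  then show ?thesis
    by (simp add: bad_def)
qed

lemma apart_measurable: "Measurable.pred (config \<Otimes>\<^sub>M config) (\<lambda>(x, y). apart x y)"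
proof -
  have "Measurable.pred (config \<Otimes>\<^sub>M config) (\<lambda>z. \<beta> \<le> norm (fst z i - snd z l))"
    if "i \<in> {..<N}" "l \<in> {..<N} - {i}" for i l
  proof -
    have [measurable]: "(\<lambda>x. x i) \<in> measurable config borel" "(\<lambda>x. x l) \<in> measurable config borel"
      using that by (auto intro: component_measurable)
    show ?thesis by measurable
  qed
  then have "Measurable.pred (config \<Otimes>\<^sub>M config)
      (\<lambda>z. \<forall>i\<in>{..<N}. \<forall>l\<in>{..<N} - {i}. \<beta> \<le> norm (fst z i - snd z l))"
    by (intro pred_intros_finite) auto
  then show ?thesis
    by (simp add: apart_def case_prod_beta)
qed

lemma plansD:
  assumes "P \<in> plans N \<rho>"
  shows "prob_space P" "sets P = sets config" "space P = space config"
    and "\<And>i X. i < N \<Longrightarrow> X \<in> sets borel \<Longrightarrow>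
      emeasure P {x\<in>space config. x i \<in> X} = emeasure \<rho> X"
proof -
  show "prob_space P" and sets: "sets P = sets config"
    using assms by (auto simp: plans_def)
  show space: "space P = space config"
    using sets by (rule sets_eq_imp_space_eq)
  fix i X assume i: "i < N" and X: "X \<in> sets (borel :: 'a measure)"
  have "(\<lambda>x. x i) \<in> measurable P borel"
    using component_measurable[OF i] sets by (simp cong: measurable_cong_sets)
  then have "emeasure (distr P borel (\<lambda>x. x i)) X = emeasure P {x\<in>space config. x i \<in> X}"
    using X by (simp add: emeasure_distr space vimage_def Int_def conj_commute)
  then show "emeasure P {x\<in>space config. x i \<in> X} = emeasure \<rho> X"
    using assms i by (simp add: plans_def)
qed

section \<open>Pointwise bounds on the truncated cost\<close>

lemma ext_phi_alpha: "ext_phi \<phi> \<alpha> = ennreal (\<phi> \<alpha>)"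
  using alpha by (simp add: ext_phi_def)

lemma ext_phi_antimono: "0 \<le> s \<Longrightarrow> s \<le> t \<Longrightarrow> ext_phi \<phi> t \<le> ext_phi \<phi> s"
  by (auto simp: ext_phi_def intro!: ennreal_leI phi_anti)

lemma trunc_cost_measurable [measurable]: "trunc_cost \<phi> \<alpha> N \<in> borel_measurable config"
proof -
  \<comment> \<open>Continuity of \<phi> is given only on the positive half-line, so its values
    elsewhere are cut off before measurability is claimed. On norms, \<open>f\<close> agrees with
    \<open>ext_phi \<phi>\<close>.\<close>
  define f where "f t = (if t \<le> 0 then \<infinity> else ennreal (indicator {0<..} t *\<^sub>R \<phi> t))" for t :: real
  have [measurable]: "(\<lambda>t. indicator {0<..} t *\<^sub>R \<phi> t) \<in> borel_measurable borel"
    using phi_cont by (intro borel_measurable_continuous_on_indicator) auto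
  have [measurable]: "f \<in> borel_measurable borel"
    unfolding f_def by measurable
  have f: "ext_phi \<phi> (norm z) = f (norm z)" for z :: 'a
    by (simp add: ext_phi_def f_def)
  have "(\<lambda>x. min (f (norm (x i - x j))) (ext_phi \<phi> \<alpha>)) \<in> borel_measurable config"
    if "j \<in> {..<N}" "i \<in> {..<j}" for i j
  proof -
    have [measurable]: "(\<lambda>x. x i) \<in> measurable config borel" "(\<lambda>x. x j) \<in> measurable config borel"
      using that by (auto intro: component_measurable)
    show ?thesis by measurable
  qed
  then show ?thesis
    unfolding trunc_cost_def f by (intro borel_measurable_sum) auto
qed

lemma trunc_cost_le_cost: "trunc_cost \<phi> \<alpha> N x \<le> cost \<phi> N x"
  unfolding trunc_cost_def cost_def by (intro sum_mono) simp

lemma trunc_cost_eq_cost: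
  assumes "x \<in> space config" "x \<notin> bad"
  shows "trunc_cost \<phi> \<alpha> N x = cost \<phi> N x"
  unfolding trunc_cost_def cost_def
proof (intro sum.cong refl)
  fix j i assume "j \<in> {..<N}" "i \<in> {..<j}"
  then have "\<alpha> \<le> norm (x i - x j)"
    using assms by (auto simp: bad_def not_less)
  then show "min (ext_phi \<phi> (norm (x i - x j))) (ext_phi \<phi> \<alpha>) = ext_phi \<phi> (norm (x i - x j))"
    using alpha by (intro min_absorb1 ext_phi_antimono) auto
qed

lemma trunc_cost_ge:
  assumes "x \<in> bad"
  shows "ennreal (\<phi> \<alpha>) \<le> trunc_cost \<phi> \<alpha> N x"
proof -
  obtain i j where ij: "j < N" "i < j" "norm (x i - x j) < \<alpha>"
    using assms by (auto simp: bad_def)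
  let ?m = "\<lambda>i j. min (ext_phi \<phi> (norm (x i - x j))) (ext_phi \<phi> \<alpha>)"
  have "ennreal (\<phi> \<alpha>) = ?m i j"
    using ij ext_phi_antimono[of "norm (x i - x j)" \<alpha>] by (simp add: ext_phi_alpha min_absorb2)
  also have "\<dots> \<le> (\<Sum>i<j. ?m i j)"
    using ij by (intro member_le_sum) auto
  also have "\<dots> \<le> trunc_cost \<phi> \<alpha> N x"
    unfolding trunc_cost_def using ij
    by (intro member_le_sum[where f = "\<lambda>j. \<Sum>i<j. ?m i j"]) auto
  finally show ?thesis .
qed

lemma trunc_cost_le:
  "trunc_cost \<phi> \<alpha> N x \<le> ennreal (real N * (real N - 1) / 2 * \<phi> \<alpha>)"
  unfolding trunc_cost_def by (rule sum_pairs_le) (simp add: ext_phi_alpha)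

lemma trunc_cost_separated_le:
  assumes "\<And>i j. i < j \<Longrightarrow> j < N \<Longrightarrow> \<beta> \<le> norm (x i - x j)"
  shows "trunc_cost \<phi> \<alpha> N x \<le> ennreal (real N * (real N - 1) / 2 * \<phi> \<beta>)"
  unfolding trunc_cost_def
proof (rule sum_pairs_le)
  fix i j assume "i < j" "j < N"
  then have "ext_phi \<phi> (norm (x i - x j)) \<le> ext_phi \<phi> \<beta>"
    using assms alpha by (intro ext_phi_antimono) auto
  then show "min (ext_phi \<phi> (norm (x i - x j))) (ext_phi \<phi> \<alpha>) \<le> ennreal (\<phi> \<beta>)"
    using alpha by (simp add: ext_phi_def min_le_iff_disj)
qed

section \<open>Separated draws, cyclic shifts and rerouting of mass\<close>

lemma shift_separated:
  assumes chain: "chain A apart N \<omega>" and ij: "i < N" "j < N" "i \<noteq> j"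
  shows "\<beta> \<le> norm (shift k \<omega> i - shift k \<omega> j)"
proof -
  let ?i = "(i + k) mod N" and ?j = "(j + k) mod N"
  \<comment> \<open>A chain relates earlier to later draws only; symmetry of \<open>apart\<close>
    covers the other order.\<close>
  have *: "apart (\<omega> m) (\<omega> m')" if "m < N" "m' < N" "m \<noteq> m'" for m m'
    using chain that apart_commute[of "\<omega> m" "\<omega> m'"]
    by (cases m m' rule: linorder_cases) (auto simp: chain_def)
  \<comment> \<open>Distinct components come from distinct draws because a rotation is injective.
    Its offset is reduced modulo \<open>N\<close>, since \<open>add_mod_bij_betw\<close> asks for an
    offset below \<open>N\<close>.\<close>
  have "?i \<noteq> ?j"
  proof -
    have "inj_on (\<lambda>i. (k mod N + i) mod N) {..<N}"
      using ij by (intro bij_betw_imp_inj_on[OF add_mod_bij_betw]) simp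
    then have "(k mod N + i) mod N \<noteq> (k mod N + j) mod N"
      using ij by (auto dest: inj_onD)
    then show ?thesis
      by (simp add: mod_simps add.commute)
  qed
  then have "apart (\<omega> ?i) (\<omega> ?j)"
    using ij by (intro *) auto
  then show ?thesis
    using ij by (simp add: shift_def apart_def)
qed

text \<open>Union bound over at most \<open>N - 1\<close> earlier draws and \<open>N (N - 1)\<close>
  ordered pairs of different components. Each forbidden event says that one component of
  \<open>y\<close> lies in a ball of radius \<beta>; as that component has law \<rho>, its
  probability is at most \<open>q\<close>.\<close>

lemma apart_prob_ge:
  assumes P: "P \<in> plans N \<rho>" and A: "A \<in> sets config"
    and F: "finite F" "F \<subseteq> space config" "card F \<le> N - 1"
  shows "measure P A - real N * (real N - 1)\<^sup>2 * q \<le> measure P {y\<in>A. \<forall>x\<in>F. apart x y}"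
proof -
  interpret prob_space P
    by (rule plansD(1)[OF P])
  note sets = plansD(2)[OF P]
  \<comment> \<open>The sign is used when the number of events is rounded up, as \<open>F\<close>
    may have fewer than \<open>N - 1\<close> elements.\<close>
  have q0: "0 \<le> q"
    using ball[of 0] measure_nonneg[of \<rho> "ball 0 \<beta>"] by linarith
  define I where "I = F \<times> Sigma {..<N} (\<lambda>i. {..<N} - {i})"
  define K where "K = (\<lambda>(x :: nat \<Rightarrow> 'a, i :: nat, l). {y\<in>space config. y l \<in> ball (x i) \<beta>})"
  define G where "G = {y\<in>A. \<forall>x\<in>F. apart x y}"
  have K: "K z \<in> events" "prob (K z) \<le> q" if z: "z \<in> I" for z
  proof -
    obtain x i l where z_eq: "z = (x, i, l)" and l: "l < N"
      using z by (auto simp: I_def)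
    have "(\<lambda>y. y l) -` ball (x i) \<beta> \<inter> space config \<in> sets config"
      by (rule measurable_sets[OF component_measurable[OF l]]) simp
    then show "K z \<in> events"
      by (simp add: sets K_def z_eq vimage_def Int_def conj_commute)
    show "prob (K z) \<le> q"
      using plansD(4)[OF P l, of "ball (x i) \<beta>"] ball[of "x i"]
      by (simp add: K_def z_eq measure_def)
  qed
  have "Measurable.pred config (\<lambda>y. \<forall>x\<in>F. apart x y)"
  proof (rule pred_intros_finite(3)[OF F(1)])
    show "Measurable.pred config (apart x)" if "x \<in> F" for x
      using measurable_compose[OF measurable_Pair1'[of x config config] apart_measurable] F that
      by (auto simp: subset_iff)
  qed
  then have "{y\<in>space config. \<forall>x\<in>F. apart x y} \<inter> A \<in> sets config"
    using A by simp
  also have "{y\<in>space config. \<forall>x\<in>F. apart x y} \<inter> A = G"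
    using sets.sets_into_space[OF A] by (auto simp: G_def)
  finally have G: "G \<in> events"
    by (simp add: sets)
  have "finite I"
    using F by (auto simp: I_def)
  have "A \<subseteq> G \<union> (\<Union>z\<in>I. K z)"
  proof
    fix y assume y: "y \<in> A"
    show "y \<in> G \<union> (\<Union>z\<in>I. K z)"
    proof (cases "y \<in> G")
      case False
      then obtain x i l where "x \<in> F" "i < N" "l < N" "l \<noteq> i" "norm (x i - y l) < \<beta>"
        using y by (auto simp: G_def apart_def not_le)
      then have "(x, i, l) \<in> I" "y \<in> K (x, i, l)"
        using y sets.sets_into_space[OF A] by (auto simp: I_def K_def dist_norm)
      then show ?thesis by blast
    qed simp
  qed
  moreover have U: "(\<Union>z\<in>I. K z) \<in> events"
    using \<open>finite I\<close> K(1) by (rule sets.finite_UN)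
  ultimately have "prob A \<le> prob (G \<union> (\<Union>z\<in>I. K z))"
    using G by (intro finite_measure_mono sets.Un)
  also have "\<dots> \<le> prob G + prob (\<Union>z\<in>I. K z)"
    using G U by (rule measure_Un_le)
  also have "prob (\<Union>z\<in>I. K z) \<le> (\<Sum>z\<in>I. prob (K z))"
    using \<open>finite I\<close> K(1) by (rule measure_UNION_le)
  also have "\<dots> \<le> real (card I) * q"
    using K(2) by (rule sum_bounded_above)
  also have "real (card I) * q \<le> real ((N - 1) * (N * (N - 1))) * q"
  proof (rule mult_right_mono[OF _ q0])
    have "card I = card F * (N * (N - 1))"
      by (simp add: I_def card_cartesian_product)
    then show "real (card I) \<le> real ((N - 1) * (N * (N - 1)))"
      using F(3) by (simp only: of_nat_le_iff) (rule mult_right_mono, simp_all)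
  qed
  also have "real ((N - 1) * (N * (N - 1))) * q = real N * (real N - 1)\<^sup>2 * q"
    using N by (simp add: of_nat_diff power2_eq_square)
  finally show ?thesis
    by (simp add: G_def)
qed

text \<open>The draws carry off mass \<open>S\<close>, their shifts bring back \<open>T\<close>, and
  the new plan is \<open>P - S + T\<close>. By \<open>room\<close>, \<open>S\<close> is at most
  \<open>P\<close>: the first term is the contribution of \<open>\<omega> 0\<close>, the second
  bounds that of the other \<open>N - 1\<close> draws, which are confined to \<open>A\<close>. The
  set \<open>A\<close> will be the whole space at first and the complement of \<open>bad\<close> at
  the end.\<close>

lemma reroute:
  assumes P: "P \<in> plans N \<rho>" and A: "A \<in> sets config" and d: "0 < d"
    and sel: "\<And>F. finite F \<Longrightarrow> F \<subseteq> space config \<Longrightarrow> card F \<le> N - 1 \<Longrightarrow>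
      d \<le> measure P {y\<in>A. \<forall>x\<in>F. apart x y}"
    and t: "0 \<le> t"
    and room: "\<And>X. X \<in> sets config \<Longrightarrow>
      t * measure P (bad \<inter> X) +
        (real N - 1) * (t * (measure P bad / d ^ (N - 1) * measure P (A \<inter> X))) \<le> measure P X"
  obtains P' where "P' \<in> plans N \<rho>"
    and "measure P' bad \<le> (1 - t) * measure P bad"
    and "(\<integral>\<^sup>+x. trunc_cost \<phi> \<alpha> N x \<partial>P') \<le> (\<integral>\<^sup>+x. trunc_cost \<phi> \<alpha> N x \<partial>P)"
proof -
  interpret prob_space P
    by (rule plansD(1)[OF P])
  note sets = plansD(2)[OF P] and space = plansD(3)[OF P]
  let ?r = "measure P bad / d ^ (N - 1)"
  have apart: "Measurable.pred (P \<Otimes>\<^sub>M P) (\<lambda>(x, y). apart x y)"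
    using apart_measurable measurable_cong_sets[OF sets_pair_measure_cong[OF sets sets]] by blast
  have sel': "ennreal d \<le> emeasure P {y\<in>A. \<forall>x\<in>F. apart x y}"
    if "finite F" "F \<subseteq> space P" "card F \<le> N - 1" for F
    using sel[of F] that by (simp add: emeasure_eq_measure space)
  obtain \<Gamma> where \<Gamma>_sets: "sets \<Gamma> = sets (Pi\<^sub>M {..N - 1} (\<lambda>_. P))"
    and \<Gamma>_AE: "AE \<omega> in \<Gamma>. \<omega> 0 \<in> bad \<and> chain A apart (Suc (N - 1)) \<omega>"
    and \<Gamma>_0: "\<And>X. X \<in> events \<Longrightarrow> emeasure \<Gamma> {\<omega>\<in>space \<Gamma>. \<omega> 0 \<in> X} = emeasure P (bad \<inter> X)"
    and \<Gamma>_k: "\<And>X k. X \<in> events \<Longrightarrow> 0 < k \<Longrightarrow> k \<le> N - 1 \<Longrightarrow> emeasure \<Gamma> {\<omega>\<in>space \<Gamma>. \<omega> k \<in> X}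
      \<le> emeasure P bad / ennreal d ^ (N - 1) * emeasure P (A \<inter> X)"
    by (rule greedy_selection[where B = bad and A = A and R = apart and d = "ennreal d" and n = "N - 1", OF _ _ apart _ sel']) (use A d in \<open>auto simp: sets\<close>)
  have \<Gamma>_chain: "AE \<omega> in \<Gamma>. chain A apart N \<omega>" and \<Gamma>_bad: "AE \<omega> in \<Gamma>. \<omega> 0 \<in> bad"
    using \<Gamma>_AE N by auto
  have comp: "(\<lambda>\<omega>. \<omega> k) \<in> measurable \<Gamma> config" if "k < N" for k
  proof -
    have "(\<lambda>\<omega>. \<omega> k) \<in> measurable (Pi\<^sub>M {..N - 1} (\<lambda>_. P)) P"
      using that by (intro measurable_component_singleton) auto
    then show ?thesis
      using measurable_cong_sets[OF \<Gamma>_sets sets[symmetric]] by simp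
  qed
  have shift: "shift k \<in> measurable \<Gamma> config" for k
    unfolding shift_def
  proof (rule measurable_restrict)
    fix i assume "i \<in> {..<N}"
    then show "(\<lambda>\<omega>. \<omega> ((i + k) mod N) i) \<in> measurable \<Gamma> borel"
      using N by (intro measurable_compose[OF comp component_measurable]) auto
  qed
  have \<Gamma>_space: "emeasure \<Gamma> (space \<Gamma>) = emeasure P bad"
  proof -
    have "{\<omega>\<in>space \<Gamma>. \<omega> 0 \<in> space P} = space \<Gamma>"
      using measurable_space[OF comp[of 0]] N by (auto simp: space)
    moreover have "bad \<inter> space P = bad"
      by (auto simp: bad_def space)
    ultimately show ?thesis
      using \<Gamma>_0[OF sets.top] by simp
  qed
  define F where "F k = scale_measure (ennreal t) (distr \<Gamma> config (\<lambda>\<omega>. \<omega> k))" for k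
  define G where "G k = scale_measure (ennreal t) (distr \<Gamma> config (shift k))" for k
  define S where "S = sum_measure config F {..<N}"
  define T where "T = sum_measure config G {..<N}"
  define D where "D = diff_measure P S"
  \<comment> \<open>Indexing by \<open>bool\<close> gives the binary sum
    \<open>D + T\<close>.\<close>
  define P' where "P' = sum_measure config (\<lambda>b. if b then D else T) UNIV"
  have sets_simps: "sets (F k) = sets config"
    "sets (G k) = sets config"
    "sets S = sets config"
    "sets T = sets config"
    "sets D = sets config"
    "sets P' = sets config" for k
    by (simp_all add: F_def G_def S_def T_def D_def P'_def sets)
  have emF: "emeasure (F k) X = ennreal t * emeasure \<Gamma> {\<omega>\<in>space \<Gamma>. \<omega> k \<in> X}"
    if "k < N" "X \<in> sets config" for k X
    using that comp by (simp add: F_def emeasure_distr vimage_def Int_def conj_commute)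
  have emG: "emeasure (G k) X = ennreal t * emeasure \<Gamma> {\<omega>\<in>space \<Gamma>. shift k \<omega> \<in> X}"
    if "X \<in> sets config" for k X
    using that shift by (simp add: G_def emeasure_distr vimage_def Int_def conj_commute)
  have S: "emeasure S X = (\<Sum>k<N. emeasure (F k) X)" if "X \<in> sets config" for X
    unfolding S_def by (rule emeasure_sum_measure) (simp_all add: sets_simps that)
  have T: "emeasure T X = (\<Sum>k<N. emeasure (G k) X)" if "X \<in> sets config" for X
    unfolding T_def by (rule emeasure_sum_measure) (simp_all add: sets_simps that)
  have S_le: "emeasure S X \<le> emeasure P X" if X: "X \<in> sets config" for X
  proof -
    have eq: "{..<N} = insert 0 {1..<N}"
      using N by auto
    define u where "u = ?r * measure P (A \<inter> X)"
    have u: "0 \<le> u"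
      using d by (simp add: u_def)
    have "emeasure S X = emeasure (F 0) X + (\<Sum>k\<in>{1..<N}. emeasure (F k) X)"
      unfolding S[OF X] eq by simp
    also have "\<dots> \<le> ennreal (t * measure P (bad \<inter> X)) +
        (\<Sum>k\<in>{1..<N}. ennreal (t * u))"
    proof (intro add_mono sum_mono)
      show "emeasure (F 0) X \<le> ennreal (t * measure P (bad \<inter> X))"
        using N X \<Gamma>_0[of X] t by (simp add: emF sets emeasure_eq_measure ennreal_mult)
      fix k assume k: "k \<in> {1..<N}"
      have "emeasure P bad / ennreal d ^ (N - 1) * emeasure P (A \<inter> X) = ennreal u"
        using d by (simp add: u_def emeasure_eq_measure ennreal_power divide_ennreal flip: ennreal_mult')
      then have "emeasure \<Gamma> {\<omega>\<in>space \<Gamma>. \<omega> k \<in> X} \<le> ennreal u"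
        using \<Gamma>_k[of X k] X k by (auto simp: sets)
      then show "emeasure (F k) X \<le> ennreal (t * u)"
        using k X t by (simp add: emF ennreal_mult' mult_left_mono)
    qed
    also have "\<dots> = ennreal (t * measure P (bad \<inter> X) + (real N - 1) * (t * u))"
      using N t u by (simp add: ennreal_plus ennreal_mult ennreal_of_nat_eq_real_of_nat of_nat_diff)
    also have "\<dots> \<le> emeasure P X"
      using room[OF X] by (simp add: u_def emeasure_eq_measure ennreal_leI)
    finally show ?thesis .
  qed
  have "finite_measure S"
  proof (rule finite_measureI)
    have "emeasure S (space config) \<le> emeasure P (space config)"
      by (rule S_le) simp
    then show "emeasure S (space S) \<noteq> \<infinity>"
      by (auto simp: S_def emeasure_eq_measure top_unique)
  qed
  then have D: "emeasure D X = emeasure P X - emeasure S X" if "X \<in> sets config" for X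
    unfolding D_def using S_le that
    by (intro emeasure_diff_measure finite_measure_axioms) (simp_all add: sets sets_simps)
  have P': "emeasure P' X = emeasure P X - emeasure S X + emeasure T X"
    if "X \<in> sets config" for X
    unfolding P'_def using that
    by (subst emeasure_sum_measure) (simp_all add: sets_simps D UNIV_bool add.commute)
  \<comment> \<open>\<open>S\<close> and \<open>T\<close> have the same marginals: on a cylinder
    over component \<open>i\<close>, the masses of the \<open>G k\<close> are those of the
    \<open>F k\<close>, permuted by the rotation by \<open>i\<close>.\<close>
  have ST: "emeasure S V = emeasure T V"
    if i: "i < N" and X: "X \<in> sets borel" and V: "V = {x\<in>space config. x i \<in> X}" for i X V
  proof -
    have V_sets: "V \<in> sets config"
      using measurable_sets[OF component_measurable[OF i] X]
      by (simp add: V vimage_def Int_def conj_commute)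
    define s where "s k = ennreal t * emeasure \<Gamma> {\<omega>\<in>space \<Gamma>. \<omega> k i \<in> X}" for k
    have "emeasure (F k) V = s k" if "k < N" for k
    proof -
      have "{\<omega>\<in>space \<Gamma>. \<omega> k \<in> V} = {\<omega>\<in>space \<Gamma>. \<omega> k i \<in> X}"
        using measurable_space[OF comp[OF that]] by (auto simp: V)
      then show ?thesis
        by (simp add: emF that V_sets s_def)
    qed
    moreover have "emeasure (G k) V = s ((i + k) mod N)" for k
    proof -
      have "{\<omega>\<in>space \<Gamma>. shift k \<omega> \<in> V} = {\<omega>\<in>space \<Gamma>. \<omega> ((i + k) mod N) i \<in> X}"
        using measurable_space[OF shift] i by (auto simp: V) (auto simp: shift_def)
      then show ?thesis
        by (simp add: emG V_sets s_def)
    qed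
    ultimately show ?thesis
      using sum.reindex_bij_betw[OF add_mod_bij_betw[OF i], of s] by (simp add: S T V_sets)
  qed
  have marginal: "distr P' borel (\<lambda>x. x i) = \<rho>" if i: "i < N" for i
  proof (rule measure_eqI)
    show "sets (distr P' borel (\<lambda>x. x i)) = sets \<rho>"
      by (simp add: rho)
    fix X assume "X \<in> sets (distr P' borel (\<lambda>x. x i))"
    then have X: "X \<in> sets borel"
      by simp
    let ?V = "{x\<in>space config. x i \<in> X}"
    have V: "?V \<in> sets config"
      using measurable_sets[OF component_measurable[OF i] X]
      by (simp add: vimage_def Int_def conj_commute)
    have "emeasure (distr P' borel (\<lambda>x. x i)) X = emeasure P' ?V"
      using component_measurable[OF i] X
      by (subst emeasure_distr) (simp_all add: P'_def vimage_def Int_def conj_commute cong: measurable_cong_sets)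
    also have "\<dots> = emeasure P ?V"
      using S_le[OF V] ST[OF i X refl] by (simp add: P'[OF V] diff_add_cancel_ennreal)
    also have "\<dots> = emeasure \<rho> X"
      by (rule plansD(4)[OF P i X])
    finally show "emeasure (distr P' borel (\<lambda>x. x i)) X = emeasure \<rho> X" .
  qed
  have "prob_space P'"
  proof -
    \<comment> \<open>The total mass is read off from one marginal, already known to be
      \<rho>.\<close>
    have "prob_space (distr P' borel (\<lambda>x. x 0))"
      using marginal[of 0] N rho by simp
    moreover have "(\<lambda>x. x 0) \<in> measurable P' borel"
      using component_measurable[of 0] N by (simp add: P'_def cong: measurable_cong_sets)
    ultimately show ?thesis
      by (rule prob_space_distrD[rotated])
  qed
  then have plan: "P' \<in> plans N \<rho>"
    using marginal by (simp add: plans_def sets_simps)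
  have "emeasure P' bad \<le> emeasure P bad - ennreal t * emeasure P bad"
  proof -
    \<comment> \<open>Shifted draws are separated by \<beta>, which is at least \<alpha>. Hence
      \<open>T\<close> does not charge \<open>bad\<close>, whereas \<open>F 0\<close> alone already
      removes the fraction \<open>t\<close> of its mass.\<close>
    have not_bad: "AE \<omega> in \<Gamma>. shift k \<omega> \<notin> bad" for k
      using \<Gamma>_chain
    proof (rule AE_mp, intro AE_I2 impI notI)
      fix \<omega> assume chain: "chain A apart N \<omega>" and "shift k \<omega> \<in> bad"
      then obtain i j where "j < N" "i < j" "norm (shift k \<omega> i - shift k \<omega> j) < \<alpha>"
        by (auto simp: bad_def)
      moreover from this have "\<beta> \<le> norm (shift k \<omega> i - shift k \<omega> j)"
        by (intro shift_separated[OF chain]) auto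
      ultimately show False
        using alpha by linarith
    qed
    have "emeasure \<Gamma> {\<omega>\<in>space \<Gamma>. shift k \<omega> \<in> bad} = 0" for k
    proof -
      have "{\<omega>\<in>space \<Gamma>. shift k \<omega> \<in> bad} \<in> sets \<Gamma>"
        using measurable_sets[OF shift bad_sets, of k] by (simp add: vimage_def Int_def conj_commute)
      then show ?thesis
        using AE_iff_measurable[of "{\<omega>\<in>space \<Gamma>. shift k \<omega> \<in> bad}" \<Gamma> "\<lambda>\<omega>. shift k \<omega> \<notin> bad"]
          not_bad[of k] by simp
    qed
    then have "emeasure T bad = 0"
      by (simp add: T emG)
    moreover have "ennreal t * emeasure P bad \<le> emeasure S bad"
    proof -
      have "ennreal t * emeasure P bad = emeasure (F 0) bad"
        using N \<Gamma>_0[of bad] by (simp add: emF sets)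
      also have "\<dots> \<le> emeasure S bad"
        unfolding S[OF bad_sets] using N by (intro member_le_sum) auto
      finally show ?thesis .
    qed
    ultimately show ?thesis
      by (simp add: P' ennreal_minus_mono)
  qed
  also have "\<dots> = ennreal ((1 - t) * measure P bad)"
    using t by (simp add: emeasure_eq_measure left_diff_distrib ennreal_minus flip: ennreal_mult)
  finally have bad_le: "emeasure P' bad \<le> ennreal ((1 - t) * measure P bad)" .
  \<comment> \<open>Returning from \<open>ennreal\<close> to reals requires
    \<open>(1 - t) * measure P bad\<close> to be nonnegative; \<open>room\<close> at the set
    \<open>bad\<close> yields this.\<close>
  have "0 \<le> (real N - 1) * (t * (?r * measure P (A \<inter> bad)))"
    using N d t by simp
  then have le: "0 \<le> (1 - t) * measure P bad"
    using room[OF bad_sets] by (simp add: left_diff_distrib)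
  have "measure P' bad \<le> (1 - t) * measure P bad"
    using enn2real_mono[OF bad_le] le by (simp add: measure_def)
  moreover have "(\<integral>\<^sup>+x. trunc_cost \<phi> \<alpha> N x \<partial>P') \<le> (\<integral>\<^sup>+x. trunc_cost \<phi> \<alpha> N x \<partial>P)"
  proof -
    let ?c = "trunc_cost \<phi> \<alpha> N"
    let ?J = "\<lambda>K. \<integral>\<^sup>+x. ?c x \<partial>K"
    \<comment> \<open>Writing \<open>P\<close> as \<open>D + S\<close> and \<open>P'\<close> as
      \<open>D + T\<close> reduces the comparison of costs to \<open>T\<close> against
      \<open>S\<close>, with no subtraction of integrals.\<close>
    have P_eq: "P = sum_measure config (\<lambda>b. if b then D else S) UNIV"
    proof (rule measure_eqI)
      fix X assume "X \<in> events"
      then show "emeasure P X = emeasure (sum_measure config (\<lambda>b. if b then D else S) UNIV) X"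
        using S_le[of X] by (subst emeasure_sum_measure)
          (simp_all add: sets sets_simps D UNIV_bool add_diff_inverse_ennreal)
    qed (simp add: sets)
    have "?J P = ?J D + ?J S"
      by (subst P_eq, subst nn_integral_sum_measure) (simp_all add: sets_simps UNIV_bool add.commute)
    moreover have "?J P' = ?J D + ?J T"
      unfolding P'_def by (subst nn_integral_sum_measure) (simp_all add: sets_simps UNIV_bool add.commute)
    moreover have "?J T \<le> ?J S"
    proof -
      have JG: "?J (G k) \<le> ennreal t * (ennreal (real N * (real N - 1) / 2 * \<phi> \<beta>) * emeasure P bad)" for k
      proof -
        have "?J (G k) = ennreal t * (\<integral>\<^sup>+\<omega>. ?c (shift k \<omega>) \<partial>\<Gamma>)"
          unfolding G_def using shift by (simp add: nn_integral_scale_measure nn_integral_distr)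
        also have "(\<integral>\<^sup>+\<omega>. ?c (shift k \<omega>) \<partial>\<Gamma>) \<le> (\<integral>\<^sup>+\<omega>. ennreal (real N * (real N - 1) / 2 * \<phi> \<beta>) \<partial>\<Gamma>)"
        proof (rule nn_integral_mono_AE, use \<Gamma>_chain in eventually_elim)
          case (elim \<omega>)
          show ?case
            by (rule trunc_cost_separated_le, rule shift_separated[OF elim]) auto
        qed
        finally show ?thesis
          by (simp add: \<Gamma>_space mult_left_mono)
      qed
      have "?J T = (\<Sum>k<N. ?J (G k))"
        unfolding T_def by (rule nn_integral_sum_measure) (simp_all add: sets_simps)
      also have "\<dots> \<le> (\<Sum>k<N. ennreal t * (ennreal (real N * (real N - 1) / 2 * \<phi> \<beta>) * emeasure P bad))"
        by (rule sum_mono) (rule JG)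
      also have "\<dots> = ennreal t * (ennreal (real N * (real N * (real N - 1) / 2 * \<phi> \<beta>)) * emeasure P bad)"
        unfolding ennreal_mult'[OF of_nat_0_le_iff[of N]]
        by (simp add: ennreal_of_nat_eq_real_of_nat mult_ac)
      \<comment> \<open>The \<open>N\<close> shifts cost at most \<open>N\<close> times the bound
        for one separated configuration; \<open>phi_alpha\<close> says that this does not exceed the
        cost of one bad configuration, paid by \<open>F 0\<close>.\<close>
      also have "\<dots> \<le> ennreal t * (ennreal (\<phi> \<alpha>) * emeasure P bad)"
        using phi_alpha by (intro mult_left_mono mult_right_mono ennreal_leI) (simp_all add: power2_eq_square mult_ac)
      also have "\<dots> = ennreal t * (\<integral>\<^sup>+\<omega>. ennreal (\<phi> \<alpha>) \<partial>\<Gamma>)"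
        by (simp add: \<Gamma>_space)
      also have "\<dots> \<le> ennreal t * (\<integral>\<^sup>+\<omega>. ?c (\<omega> 0) \<partial>\<Gamma>)"
        using \<Gamma>_bad by (intro mult_left_mono nn_integral_mono_AE) (auto intro!: trunc_cost_ge elim!: eventually_mono)
      also have "\<dots> = ?J (F 0)"
        unfolding F_def using comp[of 0] N by (simp add: nn_integral_scale_measure nn_integral_distr)
      also have "\<dots> \<le> (\<Sum>k<N. ?J (F k))"
        using N by (intro member_le_sum[where f = "\<lambda>k. ?J (F k)"]) auto
      also have "\<dots> = ?J S"
        unfolding S_def by (rule nn_integral_sum_measure[symmetric]) (simp_all add: sets_simps)
      finally show ?thesis .
    qed
    ultimately show ?thesis
      by (simp add: add_left_mono)
  qed
  ultimately show thesis
    by (rule that[OF plan])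
qed

text \<open>With \<open>A\<close> the whole space, \<open>reroute\<close> shrinks the bad mass
  geometrically. Below a fixed threshold the later draws can avoid \<open>bad\<close>, and a last
  application with \<open>t = 1\<close> clears it.\<close>

lemma remove_bad:
  assumes P: "P \<in> plans N \<rho>"
  obtains P' where "P' \<in> plans N \<rho>" and "measure P' bad = 0"
    and "(\<integral>\<^sup>+x. trunc_cost \<phi> \<alpha> N x \<partial>P') \<le> (\<integral>\<^sup>+x. trunc_cost \<phi> \<alpha> N x \<partial>P)"
proof -
  let ?J = "\<lambda>P. \<integral>\<^sup>+x. trunc_cost \<phi> \<alpha> N x \<partial>P"
  define \<kappa> where "\<kappa> = real N * (real N - 1)\<^sup>2 * q"
  \<comment> \<open>Half of the slack \<open>1 - \<kappa>\<close>. Then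
    \<open>d + \<kappa> = 1 - d\<close>, so \<open>A\<close> is large enough for the selection as
    soon as its complement has mass at most \<open>d\<close>.\<close>
  define d where "d = (1 - \<kappa>) / 2"
  define D where "D = d ^ (N - 1)"
  have d: "0 < d"
    using q by (simp add: d_def \<kappa>_def)
  then have D: "0 < D"
    by (simp add: D_def)
  have room_for: "d \<le> measure Q {y\<in>A. \<forall>x\<in>F. apart x y}"
    if "Q \<in> plans N \<rho>" "A \<in> sets config" "d + \<kappa> \<le> measure Q A"
      "finite F" "F \<subseteq> space config" "card F \<le> N - 1" for Q A F
    using apart_prob_ge[OF that(1,2,4-6)] that(3) by (simp add: \<kappa>_def)
  \<comment> \<open>Chosen so that \<open>room\<close> holds for \<open>A\<close> the whole space,
    with the bad mass estimated by 1; thus \<open>t\<close> is the same in every round.\<close>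
  define t where "t = 1 / (1 + (real N - 1) / D)"
  have pos: "0 < 1 + (real N - 1) / D"
    using N D by (simp add: add_pos_nonneg)
  then have t: "0 < t" "t * (1 + (real N - 1) / D) = 1"
    by (simp_all add: t_def)
  then have "t \<le> 1"
    using N D by (simp add: t_def)
  have shrink: "\<exists>Q'\<in>plans N \<rho>. measure Q' bad \<le> (1 - t) * measure Q bad \<and> ?J Q' \<le> ?J Q"
    if Q: "Q \<in> plans N \<rho>" for Q
  proof -
    interpret Q: prob_space Q
      by (rule plansD(1)[OF Q])
    note sets = plansD(2)[OF Q] and space = plansD(3)[OF Q]
    have "d + \<kappa> \<le> measure Q (space config)"
      using d by (simp add: Q.prob_space d_def field_simps flip: space)
    note sel = room_for[OF Q sets.top this]
    have "t * measure Q (bad \<inter> X) + (real N - 1) * (t * (measure Q bad / d ^ (N - 1) * measure Q (space config \<inter> X)))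
        \<le> measure Q X" if X: "X \<in> sets config" for X
    proof -
      have "measure Q (bad \<inter> X) \<le> measure Q X"
        using X by (intro Q.finite_measure_mono) (auto simp: sets)
      moreover have "measure Q bad / D * measure Q (space config \<inter> X) \<le> 1 / D * measure Q X"
        using D X sets.sets_into_space[OF X]
        by (intro mult_mono divide_right_mono) (auto simp: Int_absorb1)
      ultimately have "t * measure Q (bad \<inter> X) + (real N - 1) * (t * (measure Q bad / D * measure Q (space config \<inter> X)))
          \<le> t * measure Q X + (real N - 1) * (t * (1 / D * measure Q X))"
        using N t by (intro add_mono mult_left_mono) auto
      also have "\<dots> = (t * (1 + (real N - 1) / D)) * measure Q X"
        by (simp add: algebra_simps)
      finally show ?thesis
        unfolding t(2) by (simp only: D_def mult_1_left)
    qed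
    from reroute[OF Q sets.top d sel less_imp_le[OF t(1)] this] show ?thesis
      by blast
  qed
  have iterate: "\<exists>Q\<in>plans N \<rho>. measure Q bad \<le> (1 - t) ^ n \<and> ?J Q \<le> ?J P" for n
  proof (induction n)
    case 0
    interpret prob_space P
      by (rule plansD(1)[OF P])
    show ?case
      using P by auto
  next
    case (Suc n)
    then obtain Q where Q: "Q \<in> plans N \<rho>" "measure Q bad \<le> (1 - t) ^ n" "?J Q \<le> ?J P"
      by blast
    obtain Q' where Q': "Q' \<in> plans N \<rho>" "measure Q' bad \<le> (1 - t) * measure Q bad" "?J Q' \<le> ?J Q"
      using shrink[OF Q(1)] by blast
    have "(1 - t) * measure Q bad \<le> (1 - t) * (1 - t) ^ n"
      using Q(2) \<open>t \<le> 1\<close> by (intro mult_left_mono) auto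
    then show ?case
      using Q Q' by (intro bexI[of _ Q']) auto
  qed
  \<comment> \<open>The threshold \<open>d\<close> lets the later draws avoid \<open>bad\<close>;
    the threshold \<open>D / real N\<close> makes their total density with respect to the plan at
    most 1, as \<open>room\<close> with \<open>t = 1\<close> requires.\<close>
  obtain n where n: "(1 - t) ^ n < min d (D / real N)"
    using real_arch_pow_inv[of "min d (D / real N)" "1 - t"] d D N t by auto
  obtain Q where Q: "Q \<in> plans N \<rho>" "measure Q bad \<le> (1 - t) ^ n" "?J Q \<le> ?J P"
    using iterate by blast
  interpret Q: prob_space Q
    by (rule plansD(1)[OF Q(1)])
  note sets = plansD(2)[OF Q(1)] and space = plansD(3)[OF Q(1)]
  let ?m = "measure Q bad"
  let ?A = "space config - bad"
  have m: "?m \<le> d" "(real N - 1) * (?m / D) \<le> 1"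
  proof -
    show "?m \<le> d"
      using n Q(2) by simp
    have "?m \<le> D / real N"
      using n Q(2) by simp
    then have "real N * ?m \<le> D"
      using N by (simp add: field_simps)
    then have "(real N - 1) * ?m \<le> D"
      unfolding left_diff_distrib mult_1_left using measure_nonneg[of Q bad] by linarith
    then show "(real N - 1) * (?m / D) \<le> 1"
      using D by simp
  qed
  have A: "?A \<in> sets config"
    by simp
  have "measure Q ?A = 1 - ?m"
    using Q.prob_compl[of bad] by (simp add: sets space)
  then have "d + \<kappa> \<le> measure Q ?A"
    using m by (simp add: d_def field_simps)
  note sel = room_for[OF Q(1) A this]
  \<comment> \<open>Removing all of \<open>bad\<close> is possible because the later draws take mass
    only from its complement, so the two terms do not compete.\<close>
  have "1 * measure Q (bad \<inter> X) + (real N - 1) * (1 * (?m / d ^ (N - 1) * measure Q (?A \<inter> X)))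
      \<le> measure Q X" if X: "X \<in> sets config" for X
  proof -
    have "(real N - 1) * (?m / D) * measure Q (?A \<inter> X) \<le> 1 * measure Q (?A \<inter> X)"
      using m by (intro mult_right_mono) auto
    moreover have "measure Q (bad \<inter> X) + measure Q (?A \<inter> X) = measure Q ((bad \<inter> X) \<union> (?A \<inter> X))"
      using X by (intro Q.finite_measure_Union[symmetric]) (auto simp: sets)
    moreover have "(bad \<inter> X) \<union> (?A \<inter> X) = X"
      using sets.sets_into_space[OF X] by auto
    ultimately show ?thesis
      by (simp add: D_def mult.assoc)
  qed
  from reroute[OF Q(1) A d sel zero_le_one this] obtain P' where
    P': "P' \<in> plans N \<rho>" "measure P' bad \<le> (1 - 1) * ?m" "?J P' \<le> ?J Q"
    by blast
  show thesis
  proof (rule that[OF P'(1)])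
    show "measure P' bad = 0"
      using P'(2) measure_nonneg[of P' bad] by simp
    show "?J P' \<le> ?J P"
      using P'(3) Q(3) by (rule order_trans)
  qed
qed

section \<open>Equality of the minimal costs and the explicit bound\<close>

lemma min_cost_eq_min_trunc_cost: "min_cost \<phi> N \<rho> = min_trunc_cost \<phi> \<alpha> N \<rho>"
proof (rule antisym)
  show "min_cost \<phi> N \<rho> \<le> min_trunc_cost \<phi> \<alpha> N \<rho>"
    unfolding min_trunc_cost_def
  proof (rule INF_greatest)
    fix P assume "P \<in> plans N \<rho>"
    then obtain P' where P': "P' \<in> plans N \<rho>" "measure P' bad = 0"
      and le: "(\<integral>\<^sup>+x. trunc_cost \<phi> \<alpha> N x \<partial>P') \<le> (\<integral>\<^sup>+x. trunc_cost \<phi> \<alpha> N x \<partial>P)"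
      by (rule remove_bad)
    interpret P': prob_space P'
      by (rule plansD(1)[OF P'(1)])
    have "bad \<in> null_sets P'"
      using P'(2) by (simp add: null_sets_def plansD(2)[OF P'(1)] P'.emeasure_eq_measure)
    then have "AE x in P'. x \<notin> bad"
      by (rule AE_not_in)
    \<comment> \<open>Truncation changes the cost only on \<open>bad\<close>, now a null
      set.\<close>
    then have "AE x in P'. cost \<phi> N x = trunc_cost \<phi> \<alpha> N x"
      by (rule AE_mp) (use plansD(3)[OF P'(1)] in \<open>auto simp: trunc_cost_eq_cost\<close>)
    then have "(\<integral>\<^sup>+x. cost \<phi> N x \<partial>P') = (\<integral>\<^sup>+x. trunc_cost \<phi> \<alpha> N x \<partial>P')"
      by (rule nn_integral_cong_AE)
    then have "(\<integral>\<^sup>+x. cost \<phi> N x \<partial>P') \<le> (\<integral>\<^sup>+x. trunc_cost \<phi> \<alpha> N x \<partial>P)"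
      using le by simp
    with P'(1) show "min_cost \<phi> N \<rho> \<le> (\<integral>\<^sup>+x. trunc_cost \<phi> \<alpha> N x \<partial>P)"
      unfolding min_cost_def by (rule INF_lower2)
  qed
  show "min_trunc_cost \<phi> \<alpha> N \<rho> \<le> min_cost \<phi> N \<rho>"
    unfolding min_trunc_cost_def min_cost_def
    by (intro INF_superset_mono order_refl nn_integral_mono trunc_cost_le_cost)
qed

text \<open>Independent coupling: it provides a plan at which the pointwise bound on the truncated
  cost can be integrated to bound the infimum.\<close>

lemma product_plan: "Pi\<^sub>M {..<N} (\<lambda>_. \<rho>) \<in> plans N \<rho>"
proof -
  interpret prob_space \<rho>
    by (rule rho)
  have "sets (Pi\<^sub>M {..<N} (\<lambda>_. \<rho>)) = sets config"
    by (intro sets_PiM_cong refl) (rule rho)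
  moreover have "distr (Pi\<^sub>M {..<N} (\<lambda>_. \<rho>)) borel (\<lambda>x. x i) = \<rho>" if "i < N" for i
  proof -
    have "distr (Pi\<^sub>M {..<N} (\<lambda>_. \<rho>)) \<rho> (\<lambda>x. x i) = \<rho>"
      using that by (intro distr_PiM_component prob_space_axioms) auto
    then show ?thesis
      using rho(2) by (simp cong: distr_cong)
  qed
  ultimately show ?thesis
    using prob_space_PiM[of "{..<N}" "\<lambda>_. \<rho>"] prob_space_axioms by (simp add: plans_def)
qed

lemma min_cost_le: "min_cost \<phi> N \<rho> \<le> ennreal (real N * (real N - 1) / 2 * \<phi> \<alpha>)"
proof -
  let ?P = "Pi\<^sub>M {..<N} (\<lambda>_. \<rho>)"
  interpret P: prob_space ?P
    by (rule plansD(1)[OF product_plan])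
  have "(\<integral>\<^sup>+x. trunc_cost \<phi> \<alpha> N x \<partial>?P) \<le> (\<integral>\<^sup>+x. ennreal (real N * (real N - 1) / 2 * \<phi> \<alpha>) \<partial>?P)"
    by (intro nn_integral_mono trunc_cost_le)
  then have "(\<integral>\<^sup>+x. trunc_cost \<phi> \<alpha> N x \<partial>?P) \<le> ennreal (real N * (real N - 1) / 2 * \<phi> \<alpha>)"
    by (simp add: P.emeasure_space_1)
  with product_plan show ?thesis
    unfolding min_cost_eq_min_trunc_cost min_trunc_cost_def by (rule INF_lower2)
qed

end

section \<open>The truncation level given by the inverse of \<phi>\<close>

theorem proposition2p5:
  fixes N :: nat and \<phi> :: "real \<Rightarrow> real" and \<rho> :: "(real ^ 'd) measure" and \<beta> :: real
  assumes "N > 1"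
    and "\<And>t. t > 0 \<Longrightarrow> \<phi> t \<ge> 0"
    and "continuous_on {0<..} \<phi>"
    and "strict_antimono_on {0<..} \<phi>"
    and "filterlim \<phi> at_top (at_right 0)"
    and "prob_space \<rho>" and "sets \<rho> = sets borel"
    and "Lim (at_right 0) (concentration \<rho>) < 1 / (real N * (real N - 1)\<^sup>2)"
    and "\<beta> > 0"
    and "concentration \<rho> \<beta> < 1 / (real N * (real N - 1)\<^sup>2)"
  shows "min_cost \<phi> N \<rho> \<le> ennreal (real N ^ 3 * (real N - 1)\<^sup>2 / 4 * \<phi> \<beta>) \<and>
    (\<forall>\<alpha>. 0 < \<alpha> \<and>
         \<alpha> \<le> the_inv_into {0<..} \<phi> ((real N)\<^sup>2 * (real N - 1) / 2 * \<phi> \<beta>) \<longrightarrow>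
         min_cost \<phi> N \<rho> = min_trunc_cost \<phi> \<alpha> N \<rho>)"
proof -
  interpret \<rho>: prob_space \<rho>
    by fact
  define V where "V = (real N)\<^sup>2 * (real N - 1) / 2 * \<phi> \<beta>"
  have anti: "\<phi> t < \<phi> s" if "0 < s" "s < t" for s t
    using assms(4) that by (auto simp: monotone_on_def)
  \<comment> \<open>Since \<open>N\<close> is at least 2, the factor is at least 1. This puts
    \<open>V\<close> above \<open>\<phi> \<beta>\<close>, and hence its preimage \<open>a\<close>
    below \<beta>.\<close>
  have "1 \<le> (real N)\<^sup>2 * (real N - 1) / 2"
  proof -
    have "2\<^sup>2 * 1 \<le> (real N)\<^sup>2 * (real N - 1)"
      using \<open>N > 1\<close> by (intro mult_mono power_mono) auto
    then show ?thesis by simp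
  qed
  then have V: "\<phi> \<beta> \<le> V"
    using mult_right_mono[of 1 "(real N)\<^sup>2 * (real N - 1) / 2" "\<phi> \<beta>"] assms(2)[OF \<open>\<beta> > 0\<close>]
    by (simp add: V_def)
  \<comment> \<open>The blow-up of \<phi> at 0 gives a point left of \<beta> where \<phi> is at
    least \<open>V\<close>, and the intermediate value theorem gives \<open>a\<close>. So
    \<open>V\<close> is in the range of \<phi>, and \<open>the_inv_into\<close> takes its meaningful
    value there.\<close>
  obtain a where a: "0 < a" "\<phi> a = V"
  proof -
    have "eventually (\<lambda>s. V \<le> \<phi> s) (at_right 0)"
      using assms(5) by (simp add: filterlim_at_top)
    moreover have "eventually (\<lambda>s. s \<in> {0<..<\<beta>}) (at_right 0)"
      using \<open>\<beta> > 0\<close> by (rule eventually_at_right_real)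
    ultimately have "eventually (\<lambda>s. V \<le> \<phi> s \<and> s \<in> {0<..<\<beta>}) (at_right 0)"
      by (rule eventually_conj)
    then obtain s where s: "V \<le> \<phi> s" "0 < s" "s < \<beta>"
      using eventually_happens'[OF trivial_limit_at_right_real] by auto
    have "continuous_on {s..\<beta>} \<phi>"
      using s by (intro continuous_on_subset[OF assms(3)]) auto
    then obtain x where "s \<le> x" "\<phi> x = V"
      using IVT2'[of \<phi> \<beta> V s] s V by auto
    with s show thesis
      by (intro that[of x]) auto
  qed
  have "inj_on \<phi> {0<..}"
    by (rule linorder_inj_onI) (use anti in \<open>force+\<close>)
  then have inv: "the_inv_into {0<..} \<phi> V = a"
    using a the_inv_into_f_f[of \<phi> "{0<..}" a] by simp
  have "a \<le> \<beta>"
    using anti[of \<beta> a] \<open>\<beta> > 0\<close> a V by linarith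
  have rerouting: "separated_rerouting \<phi> N \<rho> \<alpha> \<beta> (concentration \<rho> \<beta>)" if \<alpha>: "0 < \<alpha>" "\<alpha> \<le> a" for \<alpha>
  proof
    show "\<phi> t \<le> \<phi> s" if "0 < s" "s \<le> t" for s t
      using anti[of s t] that by (cases "s = t") auto
    from this[OF \<alpha>] show "(real N)\<^sup>2 * (real N - 1) / 2 * \<phi> \<beta> \<le> \<phi> \<alpha>"
      by (simp add: a(2) V_def)
    show "\<alpha> \<le> \<beta>"
      using \<alpha> \<open>a \<le> \<beta>\<close> by simp
    \<comment> \<open>A real supremum dominates its terms only when they are bounded above; here the
      bound is 1.\<close>
    show "measure \<rho> (ball x \<beta>) \<le> concentration \<rho> \<beta>" for x
      unfolding concentration_def by (intro cSUP_upper bdd_aboveI[of _ 1]) auto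
    have "0 < real N * (real N - 1)\<^sup>2"
      using \<open>N > 1\<close> by simp
    then show "real N * (real N - 1)\<^sup>2 * concentration \<rho> \<beta> < 1"
      using assms(10) by (simp add: field_simps)
  qed (use assms \<alpha> in auto)
  \<comment> \<open>At the largest admissible level, the number of pairs times \<open>V\<close> is
    the stated constant.\<close>
  have "real N * (real N - 1) / 2 * \<phi> a = real N ^ 3 * (real N - 1)\<^sup>2 / 4 * \<phi> \<beta>"
    by (simp add: a V_def power2_eq_square power3_eq_cube)
  then have "min_cost \<phi> N \<rho> \<le> ennreal (real N ^ 3 * (real N - 1)\<^sup>2 / 4 * \<phi> \<beta>)"
    using separated_rerouting.min_cost_le[OF rerouting[OF a(1) order_refl]] by metis
  then show ?thesis
    using separated_rerouting.min_cost_eq_min_trunc_cost[OF rerouting]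
    unfolding V_def[symmetric] inv by blast
qed

end
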